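(* Let $h>0$, $a\in\mathbb{R}$, $b=a+mh$ with $m\in\{2,3,\ldots\}$, let $0<\alpha\le 1$ and $f:\{a,a+h,\ldots,b\}\to\mathbb{R}$. Then $$\left({_a}\Delta_h^\alpha f\right)(t)=0\quad\text{for all } t\in\{a+(1-\alpha)h,\,a+(1-\alpha)h+h,\ldots,\,b-h+(1-\alpha)h\}$$ if and only if there is a constant $c\in\mathbb{R}$ such that $$f(t)=\frac{c}{\Gamma(\alpha)}\,(t-(1-\alpha)h-a)_h^{(\alpha-1)}\quad\text{for all } t\in\{a,a+h,\ldots,b\}.$$
   Context: For $h>0$ and $x,y\in\mathbb{R}$ the $h$-factorial function is $x_h^{(y)} = h^y\,\dfrac{\Gamma(\frac{x}{h}+1)}{\Gamma(\frac{x}{h}+1-y)}$, where $\Gamma$ is the Euler gamma function, with the convention that division at a pole yields zero. Put $\sigma_h(t)=t+h$ and $(\Delta_h g)(t)=\frac{g(t+h)-g(t)}{h}$. For $f:\{a,a+h,\ldots,b\}\to\mathbb{R}$ the left fractional $h$-sum of order $\nu>0$ is $$\left({_a}\Delta_h^{-\nu}f\right)(t)=\frac{1}{\Gamma(\nu)}\sum_{k=\frac{a}{h}}^{\frac{t}{h}-\nu}(t-\sigma_h(kh))_h^{(\nu-1)}f(kh)\,h,\quad t\in\{a+\nu h,a+\nu h+h,\ldots,b+\nu h\},$$ where $k$ runs in unit steps (limits not necessarily integers), and ${_a}\Delta_h^{0}f=f$. For $0<\alpha\le1$ and $\gamma=1-\alpha$, the left fractional $h$-difference of order $\alpha$ is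 $$\left({_a}\Delta_h^{\alpha}f\right)(t)=\left(\Delta_h\,{_a}\Delta_h^{-\gamma}f\right)(t),\quad t\in\{a+\gamma h,a+\gamma h+h,\ldots,b-h+\gamma h\}.$$ *)

theory Defs
  imports "HOL-Analysis.Analysis"
begin

(* The library sets Gamma to 0 at its poles and x / 0 = 0, so that division at a pole
   of the denominator yields 0 here. *)
definition h_factorial :: "real \<Rightarrow> real \<Rightarrow> real \<Rightarrow> real" where
  "h_factorial h x y = h powr y * (Gamma (x / h + 1) / Gamma (x / h + 1 - y))"

definition h_sigma :: "real \<Rightarrow> real \<Rightarrow> real" where
  "h_sigma h t = t + h"

definition h_diff :: "real \<Rightarrow> (real \<Rightarrow> real) \<Rightarrow> real \<Rightarrow> real" where
  "h_diff h g t = (g (t + h) - g t) / h"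

(* {p, p + s, ..., q}; for s > 0 the grid is finite, and it is empty if q < p. *)
definition steps :: "real \<Rightarrow> real \<Rightarrow> real \<Rightarrow> real set" where
  "steps s p q = {p + real i * s | i. p + real i * s \<le> q}"

(* Functions on the grid {a, a + h, ..., b} are represented by total functions. For t in
   the grid {a + \<nu> h, ..., b + \<nu> h} only the values of f on {a, a + h, ..., b} are used.
   The order \<nu> is meant to be nonnegative. *)
definition left_frac_sum :: "real \<Rightarrow> real \<Rightarrow> real \<Rightarrow> (real \<Rightarrow> real) \<Rightarrow> real \<Rightarrow> real" where
  "left_frac_sum h a \<nu> f t =
     (if \<nu> = 0 then f t
      else 1 / Gamma \<nu> *
        (\<Sum>k\<in>steps 1 (a / h) (t / h - \<nu>).
           h_factorial h (t - h_sigma h (k * h)) (\<nu> - 1) * f (k * h) * h))"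

definition left_frac_diff :: "real \<Rightarrow> real \<Rightarrow> real \<Rightarrow> (real \<Rightarrow> real) \<Rightarrow> real \<Rightarrow> real" where
  "left_frac_diff h a \<alpha> f = h_diff h (left_frac_sum h a (1 - \<alpha>) f)"

end

theory Submission imports Defs begin

text \<open>
  On the grid, the fractional sum of order \<open>\<gamma>\<close> is the convolution with the coefficients
  \<open>(\<gamma>)\<^sub>k / k!\<close> of \<open>(1 - x) powr (-\<gamma>)\<close>, and the functions on the right-hand side of the
  theorem are the multiples of the coefficients \<open>(\<alpha>)\<^sub>k / k!\<close> of \<open>(1 - x) powr (-\<alpha>)\<close>. For
  \<open>\<gamma> = 1 - \<alpha>\<close> the product of the two series is \<open>1 / (1 - x)\<close>, whose coefficients are constant.
  Conversely, since \<open>(\<gamma>)\<^sub>0 / 0! = 1\<close>, convolution with the first series is injective, so only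
  these functions have a constant fractional sum, that is, a vanishing fractional difference.
\<close>

lemma steps_grid:
  assumes "s > 0"
  shows "steps s p (p + real n * s) = (\<lambda>i. p + real i * s) ` {..n}"
  using assms by (auto simp: steps_def)

lemma Gamma_add_nat:
  fixes x :: real
  assumes "x > 0"
  shows "Gamma (x + real k) = pochhammer x k * Gamma x"
proof -
  have "x \<notin> \<int>\<^sub>\<le>\<^sub>0"
    using assms by (auto simp: nonpos_Ints_def)
  then have "pochhammer x k = Gamma (x + real k) / Gamma x"
    by (rule pochhammer_Gamma)
  then show ?thesis
    using Gamma_real_pos[OF assms] by simp
qed

text \<open>Here \<open>x / h + 1 = y + k\<close>, and the Gamma function in the denominator is
  taken at \<open>k + 1\<close>; no pole is met, and the quotient is
  \<open>Gamma (y + k) / k!\<close>.\<close>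

lemma h_factorial_pochhammer:
  assumes "h > 0" and "y > 0" and "x = (real k + y - 1) * h"
  shows "h_factorial h x (y - 1) = h powr (y - 1) * Gamma y * (pochhammer y k / fact k)"
proof -
  have "x / h = real k + y - 1"
    using assms by simp
  then have "h_factorial h x (y - 1) = h powr (y - 1) * (Gamma (y + real k) / Gamma (1 + real k))"
    by (simp add: h_factorial_def algebra_simps)
  also have "Gamma (1 + real k) = fact k"
    by (rule Gamma_fact)
  finally show ?thesis
    using assms by (simp add: Gamma_add_nat)
qed

text \<open>For \<gamma> > 0 the kernel at index \<open>i\<close> has argument
  \<open>(n - i + \<gamma> - 1) * h\<close>. Its factor \<open>Gamma \<gamma>\<close> cancels the
  prefactor, and the step width \<open>h\<close> raises the power of \<open>h\<close> from \<gamma>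
  - 1 to \<gamma>.\<close>

lemma left_frac_sum_convolution:
  assumes "h > 0" and "\<gamma> \<ge> 0"
  shows "left_frac_sum h a \<gamma> f (a + \<gamma> * h + real n * h) =
    h powr \<gamma> * (\<Sum>i\<le>n. pochhammer \<gamma> (n - i) / fact (n - i) * f (a + real i * h))"
    (is "left_frac_sum h a \<gamma> f ?t = _")
proof (cases "\<gamma> = 0")
  case True
  \<comment> \<open>This case serves \<alpha> = 1: \<open>pochhammer 0 k\<close> is 0 for
    \<open>k > 0\<close> and 1 for \<open>k = 0\<close>, which matches the separate clause for order
    zero.\<close>
  have "(\<Sum>i\<le>n. pochhammer \<gamma> (n - i) / fact (n - i) * f (a + real i * h)) =
      (\<Sum>i\<le>n. if i = n then f (a + real i * h) else 0)"
    using True by (intro sum.cong) (auto simp: pochhammer_0_left)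
  then show ?thesis
    using True assms by (simp add: left_frac_sum_def)
next
  case False
  with assms have \<gamma>: "\<gamma> > 0"
    by simp
  \<comment> \<open>The limits differ by the integer \<open>n\<close> even if \<open>a / h\<close>
    is not an integer.\<close>
  have "?t / h - \<gamma> = a / h + real n * 1"
    using assms by (simp add: field_simps)
  then have steps: "steps 1 (a / h) (?t / h - \<gamma>) = (\<lambda>i. a / h + real i) ` {..n}"
    using steps_grid[of 1 "a / h" n] by simp
  have term_eq: "h_factorial h (?t - h_sigma h ((a / h + real i) * h)) (\<gamma> - 1)
        * f ((a / h + real i) * h) * h =
      Gamma \<gamma> * (h powr \<gamma> * (pochhammer \<gamma> (n - i) / fact (n - i) * f (a + real i * h)))"
    if "i \<le> n" for i
  proof -
    have "(a / h + real i) * h = a + real i * h"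
      using assms by (simp add: field_simps)
    moreover have "?t - h_sigma h (a + real i * h) = (real (n - i) + \<gamma> - 1) * h"
      using that by (simp add: h_sigma_def of_nat_diff algebra_simps)
    moreover have "h powr (\<gamma> - 1) * h = h powr \<gamma>"
      using assms by (simp add: powr_diff)
    ultimately show ?thesis
      using h_factorial_pochhammer[OF \<open>h > 0\<close> \<gamma>, of _ "n - i"] by (simp add: mult_ac)
  qed
  have "left_frac_sum h a \<gamma> f ?t = 1 / Gamma \<gamma> *
      (\<Sum>i\<le>n. Gamma \<gamma> * (h powr \<gamma> * (pochhammer \<gamma> (n - i) / fact (n - i) * f (a + real i * h))))"
    using False term_eq by (simp add: left_frac_sum_def steps sum.reindex inj_on_def)
  also have "\<dots> = h powr \<gamma> * (\<Sum>i\<le>n. pochhammer \<gamma> (n - i) / fact (n - i) * f (a + real i * h))"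
    using Gamma_real_pos[OF \<gamma>] by (simp only: flip: sum_distrib_left) simp
  finally show ?thesis .
qed

text \<open>Vandermonde's identity for rising factorials, divided by \<open>n!\<close>: the
  coefficients in \<open>(1 - z)^(-x) * (1 - z)^(-y) = (1 - z)^(-(x + y))\<close>.\<close>

lemma pochhammer_convolution:
  fixes x y :: "'a :: field_char_0"
  shows "(\<Sum>i\<le>n. pochhammer x (n - i) / fact (n - i) * (pochhammer y i / fact i)) =
    pochhammer (x + y) n / fact n"
proof -
  have "pochhammer (y + x) n / fact n =
      (\<Sum>i\<le>n. of_nat (n choose i) * pochhammer y i * pochhammer x (n - i) / fact n)"
    by (simp add: pochhammer_binomial_sum sum_divide_distrib)
  also have "\<dots> = (\<Sum>i\<le>n. pochhammer x (n - i) / fact (n - i) * (pochhammer y i / fact i))"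
    by (intro sum.cong) (auto simp: binomial_fact mult_ac)
  finally show ?thesis
    by (simp add: add.commute)
qed

text \<open>A triangular system with diagonal entry \<open>w 0\<close>: once the values at smaller
  indices agree, the equation at \<open>n\<close> reduces to
  \<open>w 0 * u n = w 0 * v n\<close>.\<close>

lemma convolution_inj:
  fixes w u v :: "nat \<Rightarrow> 'a :: idom"
  assumes "w 0 \<noteq> 0"
    and "\<And>n. n \<le> m \<Longrightarrow> (\<Sum>i\<le>n. w (n - i) * u i) = (\<Sum>i\<le>n. w (n - i) * v i)"
    and "n \<le> m"
  shows "u n = v n"
  using assms(3)
proof (induction n rule: less_induct)
  case (less n)
  then have "(\<Sum>i<n. w (n - i) * u i) = (\<Sum>i<n. w (n - i) * v i)"
    by (intro sum.cong) auto
  with assms(2)[OF less.prems] have "w 0 * u n = w 0 * v n"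
    by (simp flip: lessThan_Suc_atMost)
  with assms(1) show ?case
    by simp
qed

lemma eq_consecutive_iff_const:
  "(\<forall>n<m. g (Suc n) = g n) \<longleftrightarrow> (\<forall>n\<le>m. g n = g 0)"
proof
  assume step: "\<forall>n<m. g (Suc n) = g n"
  have "g n = g 0" if "n \<le> m" for n
    using that by (induction n) (use step in auto)
  then show "\<forall>n\<le>m. g n = g 0"
    by blast
qed (metis Suc_leI less_imp_le)

theorem theorem15:
  fixes h a b \<alpha> :: real and m :: nat and f :: "real \<Rightarrow> real"
  assumes "h > 0" and "m \<ge> 2" and "b = a + real m * h"
    and "0 < \<alpha>" and "\<alpha> \<le> 1"
  shows "(\<forall>t \<in> steps h (a + (1 - \<alpha>) * h) (b - h + (1 - \<alpha>) * h). left_frac_diff h a \<alpha> f t = 0)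
    \<longleftrightarrow> (\<exists>c::real. \<forall>t \<in> steps h a b.
          f t = c / Gamma \<alpha> * h_factorial h (t - (1 - \<alpha>) * h - a) (\<alpha> - 1))"
proof -
  define \<gamma> where "\<gamma> = 1 - \<alpha>"
  define w where "w k = pochhammer \<gamma> k / fact k" for k
  define p where "p k = pochhammer \<alpha> k / fact k" for k
  define u where "u i = f (a + real i * h)" for i
  define S where "S n = (\<Sum>i\<le>n. w (n - i) * u i)" for n
  \<comment> \<open>Since \<gamma> + \<alpha> = 1, the convolution is
    \<open>pochhammer 1 n / n! = 1\<close>.\<close>
  have conv_p: "(\<Sum>i\<le>n. w (n - i) * p i) = 1" for n
    unfolding w_def p_def pochhammer_convolution by (simp add: \<gamma>_def flip: pochhammer_fact)
  have conv_scaled: "(\<Sum>i\<le>n. w (n - i) * (c * p i)) = c" for n c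
  proof -
    have "(\<Sum>i\<le>n. w (n - i) * (c * p i)) = c * (\<Sum>i\<le>n. w (n - i) * p i)"
      by (simp add: sum_distrib_left mult_ac)
    then show ?thesis
      by (simp add: conv_p)
  qed
  have sum_S: "left_frac_sum h a \<gamma> f (a + \<gamma> * h + real n * h) = h powr \<gamma> * S n" for n
    using assms by (simp add: left_frac_sum_convolution S_def w_def u_def \<gamma>_def)
  have diff_S: "left_frac_diff h a \<alpha> f (a + \<gamma> * h + real n * h) = 0 \<longleftrightarrow> S (Suc n) = S n" for n
  proof -
    have "left_frac_diff h a \<alpha> f (a + \<gamma> * h + real n * h) =
        (h powr \<gamma> * S (Suc n) - h powr \<gamma> * S n) / h"
      using sum_S[of "Suc n"] sum_S[of n]
      by (simp add: left_frac_diff_def h_diff_def algebra_simps flip: \<gamma>_def)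
    then show ?thesis
      using assms by simp
  qed
  \<comment> \<open>The grid of the difference ends one step before that of \<open>f\<close>, at
    index \<open>m - 1\<close>.\<close>
  have "{..m - 1} = {..<m}"
    using assms by auto
  moreover have "b - h + \<gamma> * h = (a + \<gamma> * h) + real (m - 1) * h"
    using assms by (simp add: of_nat_diff algebra_simps)
  ultimately have steps_diff:
    "steps h (a + \<gamma> * h) (b - h + \<gamma> * h) = (\<lambda>n. a + \<gamma> * h + real n * h) ` {..<m}"
    using steps_grid[OF \<open>h > 0\<close>, of "a + \<gamma> * h" "m - 1"] by (simp only:)
  have steps_f: "steps h a b = (\<lambda>n. a + real n * h) ` {..m}"
    using assms steps_grid[of h a m] by simp
  have rhs: "c / Gamma \<alpha> * h_factorial h (a + real n * h - \<gamma> * h - a) (\<alpha> - 1) =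
      c * h powr (\<alpha> - 1) * p n" for c n
  proof -
    have "a + real n * h - \<gamma> * h - a = (real n + \<alpha> - 1) * h"
      by (simp add: \<gamma>_def algebra_simps)
    then show ?thesis
      using assms less_imp_neq[OF Gamma_real_pos[OF \<open>0 < \<alpha>\<close>]] by (simp add: h_factorial_pochhammer p_def)
  qed
  have "(\<forall>t \<in> steps h (a + \<gamma> * h) (b - h + \<gamma> * h). left_frac_diff h a \<alpha> f t = 0)
      \<longleftrightarrow> (\<forall>n<m. S (Suc n) = S n)"
    unfolding steps_diff ball_simps diff_S by blast
  also have "\<dots> \<longleftrightarrow> (\<forall>n\<le>m. S n = S 0)"
    by (rule eq_consecutive_iff_const)
  also have "\<dots> \<longleftrightarrow> (\<exists>c. \<forall>n\<le>m. u n = c * p n)"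
  proof
    assume const: "\<forall>n\<le>m. S n = S 0"
    \<comment> \<open>All convolutions of \<open>S 0 * p\<close> with \<open>w\<close> equal
      \<open>S 0\<close>, as do those of \<open>u\<close> up to \<open>m\<close>, so injectivity
      applies.\<close>
    have "u n = S 0 * p n" if "n \<le> m" for n
    proof (rule convolution_inj[where w = w and m = m])
      show "(\<Sum>i\<le>n. w (n - i) * u i) = (\<Sum>i\<le>n. w (n - i) * (S 0 * p i))" if "n \<le> m" for n
        using const that unfolding conv_scaled S_def by blast
    qed (use that in \<open>auto simp: w_def\<close>)
    then show "\<exists>c. \<forall>n\<le>m. u n = c * p n"
      by blast
  next
    assume "\<exists>c. \<forall>n\<le>m. u n = c * p n"
    then obtain c where "\<forall>n\<le>m. u n = c * p n" ..
    then have "S n = c" if "n \<le> m" for n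
      using that conv_scaled[of n c] by (simp add: S_def)
    then show "\<forall>n\<le>m. S n = S 0"
      by simp
  qed
  also have "\<dots> \<longleftrightarrow> (\<exists>c. \<forall>n\<le>m. u n = c * h powr (\<alpha> - 1) * p n)"
    (is "_ \<longleftrightarrow> (\<exists>c. ?scaled c)")
  proof
    assume "\<exists>c. \<forall>n\<le>m. u n = c * p n"
    then obtain c where "\<forall>n\<le>m. u n = c * p n" ..
    \<comment> \<open>The factor \<open>h powr (\<alpha> - 1)\<close> is nonzero and can be absorbed
      into the constant.\<close>
    then have "?scaled (c / h powr (\<alpha> - 1))"
      using assms by simp
    then show "\<exists>c. ?scaled c" ..
  qed blast
  also have "\<dots> \<longleftrightarrow> (\<exists>c. \<forall>t \<in> steps h a b.
      f t = c / Gamma \<alpha> * h_factorial h (t - \<gamma> * h - a) (\<alpha> - 1))"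
    unfolding steps_f ball_simps rhs u_def by blast
  finally show ?thesis
    unfolding \<gamma>_def .
qed

end
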